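(* Let $\{\phi_j\}_{j=1}^N$ be an orthonormal basis of $\mathbb{C}^N$, and let $A_j=(a^{(j)}_{k\ell})_{k,\ell=1}^N$, $j=1,\dots,S$, be complex $N\times N$ matrices. For $\mathfrak{g}\in\mathbb{C}^N$ let $\mathcal{G}:=\{\mathfrak{g}_{m,\ell}:m=1,\dots,S,\ \ell=1,\dots,N\}$ with $\mathfrak{g}_{m,\ell}:=\phi_\ell\circ(A_m\mathfrak{g})$. For $k=1,\dots,N$ let $$C_k:=\left(\sum_{j=1}^S a^{(j)}_{k\ell}\,\overline{a^{(j)}_{km}}\right)_{\ell,m=1}^N\in\mathbb{C}^{N\times N},$$ and assume $C_1,\dots,C_N$ are positive definite. Then $$\sup_{\|\mathfrak{g}\|=1}c(\mathcal{G})=\max_{k,\ell=1,\dots,N}\lambda_{\max}(C_k,C_\ell).$$ Equality is attained when $\mathfrak{g}$ is an eigenvector associated to the generalized eigenvalue problem $C_{k^*}-\lambda C_{\ell^*}$, where $k^*$ and $\ell^*$ are values of $k$ and $\ell$ attaining the maximum on the right-hand side.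
   Context: The symbol $\circ$ denotes the entrywise product. A finite family $\mathcal F=\{\psi_x\}$ in $\mathbb{C}^N$ is a frame if there are $A,B>0$ with $A\|f\|_2^2\le\sum_x|\langle f,\psi_x\rangle|^2\le B\|f\|_2^2$ for all $f\in\mathbb{C}^N$. Its condition number is $c(\mathcal F)=B/A$ where $A$ and $B$ are the optimal (largest, resp. smallest) such constants. For Hermitian positive definite matrices $P,Q$, $\lambda_{\max}(P,Q)$ denotes the largest eigenvalue of the matrix pencil $P-zQ$, where $\lambda$ is an eigenvalue of the pencil if $\det(P-\lambda Q)=0$ (all such $\lambda$ are real here); an associated eigenvector is a nonzero $v\in\mathbb{C}^N$ with $Pv=\lambda Qv$.
   Formalization: With C_k as defined, equality holds when the complex conjugate of g (rather than g itself) is an eigenvector of C_{k*} − λC_{l*} for its largest eigenvalue; for g itself the claim fails for some complex C_k. *)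

theory Defs
  imports "HOL-Analysis.Analysis"
begin

definition cinner :: "complex ^ 'n \<Rightarrow> complex ^ 'n \<Rightarrow> complex" where
  "cinner x y = (\<Sum>i\<in>UNIV. x $ i * cnj (y $ i))"

definition conj_vec :: "complex ^ 'n \<Rightarrow> complex ^ 'n" where
  "conj_vec v = (\<chi> i. cnj (v $ i))"

definition orthonormal_basis :: "('n \<Rightarrow> complex ^ 'n) \<Rightarrow> bool" where
  "orthonormal_basis \<phi> \<longleftrightarrow>
     (\<forall>i j. cinner (\<phi> i) (\<phi> j) = (if i = j then 1 else 0)) \<and> vec.span (range \<phi>) = UNIV"

(* A frame is a family indexed by I, so vectors count with multiplicity. *)

definition lower_frame_bound :: "'i set \<Rightarrow> ('i \<Rightarrow> complex ^ 'n) \<Rightarrow> real \<Rightarrow> bool" where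
  "lower_frame_bound I \<psi> a \<longleftrightarrow>
     a > 0 \<and> (\<forall>f. a * (norm f)\<^sup>2 \<le> (\<Sum>x\<in>I. (cmod (cinner f (\<psi> x)))\<^sup>2))"

definition upper_frame_bound :: "'i set \<Rightarrow> ('i \<Rightarrow> complex ^ 'n) \<Rightarrow> real \<Rightarrow> bool" where
  "upper_frame_bound I \<psi> b \<longleftrightarrow>
     b > 0 \<and> (\<forall>f. (\<Sum>x\<in>I. (cmod (cinner f (\<psi> x)))\<^sup>2) \<le> b * (norm f)\<^sup>2)"

definition is_frame :: "'i set \<Rightarrow> ('i \<Rightarrow> complex ^ 'n) \<Rightarrow> bool" where
  "is_frame I \<psi> \<longleftrightarrow>
     finite I \<and> (\<exists>a. lower_frame_bound I \<psi> a) \<and> (\<exists>b. upper_frame_bound I \<psi> b)"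

(* Meaningful only for frames: otherwise the extremal bounds need not exist. *)
definition frame_cond :: "'i set \<Rightarrow> ('i \<Rightarrow> complex ^ 'n) \<Rightarrow> real" where
  "frame_cond I \<psi> =
     (LEAST b. upper_frame_bound I \<psi> b) / (GREATEST a. lower_frame_bound I \<psi> a)"

definition positive_definite :: "complex ^ 'n ^ 'n \<Rightarrow> bool" where
  "positive_definite P \<longleftrightarrow>
     (\<forall>i j. P $ i $ j = cnj (P $ j $ i)) \<and> (\<forall>v. v \<noteq> 0 \<longrightarrow> Re (cinner (P *v v) v) > 0)"

definition pencil_eigenvalue :: "complex ^ 'n ^ 'n \<Rightarrow> complex ^ 'n ^ 'n \<Rightarrow> complex \<Rightarrow> bool" where
  "pencil_eigenvalue P Q z \<longleftrightarrow> det (P - (\<chi> i j. z * Q $ i $ j)) = 0"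

definition pencil_eigenvector ::
    "complex ^ 'n ^ 'n \<Rightarrow> complex ^ 'n ^ 'n \<Rightarrow> complex \<Rightarrow> complex ^ 'n \<Rightarrow> bool" where
  "pencil_eigenvector P Q z v \<longleftrightarrow> v \<noteq> 0 \<and> P *v v = z *s (Q *v v)"

(* For positive definite P and Q there are finitely many eigenvalues, at least one, and all are
   real, so the maximum is that of a finite nonempty set containing every eigenvalue. *)
definition lambda_max :: "complex ^ 'n ^ 'n \<Rightarrow> complex ^ 'n ^ 'n \<Rightarrow> real" where
  "lambda_max P Q = Max {x. pencil_eigenvalue P Q (complex_of_real x)}"

(* Multiplication of vectors is entrywise. *)
definition window_family ::
    "('n \<Rightarrow> complex ^ 'n) \<Rightarrow> (nat \<Rightarrow> complex ^ 'n ^ 'n) \<Rightarrow> complex ^ 'n \<Rightarrow> nat \<times> 'n \<Rightarrow> complex ^ 'n" where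
  "window_family \<phi> A g = (\<lambda>(m, l). \<phi> l * (A m *v g))"

(* With this placement of the conjugation, the sum over j of |(A_j g)_k|^2 is
   cinner (C_k v) v for v = conj_vec g, not for v = g. *)
definition C_mat :: "nat \<Rightarrow> (nat \<Rightarrow> complex ^ 'n ^ 'n) \<Rightarrow> 'n \<Rightarrow> complex ^ 'n ^ 'n" where
  "C_mat S A k = (\<chi> l m. \<Sum>j\<in>{1..S}. A j $ k $ l * cnj (A j $ k $ m))"

end

theory Submission
  imports Defs
begin

text \<open>
  By Parseval for the basis \<open>\<phi>\<close>, the frame operator of the family generated by \<open>g\<close> is diagonal, with
  entries \<open>d k = cinner (C\<^sub>k v) v\<close> for \<open>v = conj_vec g\<close>, so its condition number is the largest ratio
  \<open>d k / d l\<close>. This is a generalized Rayleigh quotient, whose maximum over \<open>v \<noteq> 0\<close> is the largest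
  eigenvalue of the pencil of \<open>C\<^sub>k\<close> and \<open>C\<^sub>l\<close>: at a maximizer with value \<open>x\<close>, the positive
  semidefinite matrix \<open>x C\<^sub>l - C\<^sub>k\<close> has an isotropic vector, which must lie in its kernel.
\<close>

section \<open>Hermitian forms and their isotropic vectors\<close>

definition qform :: "complex ^ 'n ^ 'n \<Rightarrow> complex ^ 'n \<Rightarrow> real" where
  "qform P v = Re (cinner (P *v v) v)"

text \<open>Split off from \<open>positive_definite\<close> because it is also needed for the
  difference \<open>x C_l - C_k\<close>, which is only semidefinite.\<close>

definition hermitian :: "complex ^ 'n ^ 'n \<Rightarrow> bool" where
  "hermitian P \<longleftrightarrow> (\<forall>i j. P $ i $ j = cnj (P $ j $ i))"

lemma cinner_add_left: "cinner (x + y) z = cinner x z + cinner y z"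
  by (simp add: cinner_def algebra_simps sum.distrib)

lemma cinner_add_right: "cinner x (y + z) = cinner x y + cinner x z"
  by (simp add: cinner_def algebra_simps sum.distrib)

lemma cinner_diff_left: "cinner (x - y) z = cinner x z - cinner y z"
  by (simp add: cinner_def algebra_simps sum_subtractf)

lemma cinner_scale_left: "cinner (a *s x) y = a * cinner x y"
  by (simp add: cinner_def sum_distrib_left algebra_simps)

lemma cinner_scale_right: "cinner x (a *s y) = cnj a * cinner x y"
  by (simp add: cinner_def sum_distrib_left algebra_simps)

lemma cinner_commute: "cinner y x = cnj (cinner x y)"
  by (simp add: cinner_def mult.commute)

lemma norm_vec_squared: "(norm (x :: complex ^ 'n))\<^sup>2 = (\<Sum>i\<in>UNIV. (cmod (x $ i))\<^sup>2)"
  by (simp add: norm_vec_def L2_set_def sum_nonneg)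

lemma cinner_self: "cinner x x = complex_of_real ((norm x)\<^sup>2)"
  by (simp add: cinner_def norm_vec_squared complex_norm_square[symmetric])

lemma hermitian_cinner:
  assumes "hermitian P"
  shows "cinner (P *v x) y = cinner x (P *v y)"
proof -
  have conj: "cnj (P $ j $ i) = P $ i $ j" for i j
    using assms unfolding hermitian_def by metis
  have "cinner (P *v x) y = (\<Sum>i\<in>UNIV. \<Sum>j\<in>UNIV. P $ i $ j * x $ j * cnj (y $ i))"
    by (simp add: cinner_def matrix_vector_mult_def sum_distrib_right)
  also have "\<dots> = (\<Sum>j\<in>UNIV. \<Sum>i\<in>UNIV. P $ i $ j * x $ j * cnj (y $ i))"
    by (rule sum.swap)
  also have "\<dots> = (\<Sum>j\<in>UNIV. \<Sum>i\<in>UNIV. x $ j * (cnj (P $ j $ i) * cnj (y $ i)))"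
    by (simp add: conj mult_ac)
  also have "\<dots> = cinner x (P *v y)"
    by (simp add: cinner_def matrix_vector_mult_def sum_distrib_left)
  finally show ?thesis .
qed

lemma continuous_on_qform: "continuous_on X (qform P)"
  unfolding qform_def cinner_def matrix_vector_mult_def
  by (simp, intro continuous_intros)

lemma qform_scale: "qform P (a *s v) = (cmod a)\<^sup>2 * qform P v"
proof -
  have "cinner (P *v (a *s v)) (a *s v) = (a * cnj a) * cinner (P *v v) v"
    by (simp add: matrix_vector_mult_scaleR vec.scale cinner_scale_left cinner_scale_right)
  then show ?thesis
    by (simp add: qform_def complex_norm_square[symmetric])
qed

lemma positive_definiteD:
  assumes "positive_definite P"
  shows "hermitian P" "v \<noteq> 0 \<Longrightarrow> qform P v > 0"
  using assms unfolding positive_definite_def hermitian_def qform_def by blast+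

lemma qform_add_real:
  assumes "hermitian H"
  shows "qform H (v + of_real t *s w) = qform H v + 2 * t * Re (cinner (H *v v) w) + t\<^sup>2 * qform H w"
proof -
  have "cinner (H *v w) v = cnj (cinner (H *v v) w)"
    using hermitian_cinner[OF assms] cinner_commute by metis
  then have "Re (cinner (H *v w) v) = Re (cinner (H *v v) w)"
    by simp
  then show ?thesis
    by (simp add: qform_def matrix_vector_right_distrib vec.scale cinner_add_left cinner_add_right
        cinner_scale_left cinner_scale_right power2_eq_square algebra_simps)
qed

text \<open>Move from \<open>v\<close> along \<open>w = H *v v\<close>: the form becomes
  \<open>2 * t * (norm w)\<^sup>2 + t\<^sup>2 * qform H w\<close>. If \<open>w\<close> were nonzero,
  the linear term would make this negative for small negative \<open>t\<close>.\<close>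

lemma qform_isotropic_imp_kernel:
  assumes "hermitian H" and nonneg: "\<And>w. qform H w \<ge> 0" and "qform H v = 0"
  shows "H *v v = 0"
proof (rule ccontr)
  assume ne: "H *v v \<noteq> 0"
  define w where "w = H *v v"
  define a where "a = (norm w)\<^sup>2"
  define b where "b = qform H w"
  have a: "a > 0" and b: "b \<ge> 0"
    using ne nonneg by (auto simp: a_def w_def b_def)
  have "0 \<le> 2 * t * a + t\<^sup>2 * b" for t
    using nonneg[of "v + of_real t *s w"] qform_add_real[OF assms(1), of v t w] assms(3)
    by (simp add: w_def[symmetric] cinner_self a_def b_def)
  \<comment> \<open>The quadratic is minimal at \<open>- a / b\<close>; replacing \<open>b\<close>
    by \<open>b + 1\<close> covers the case \<open>b = 0\<close> and still gives a negative
    value.\<close>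
  from this[of "- a / (b + 1)"] have "2 * a\<^sup>2 / (b + 1) \<le> a\<^sup>2 * b / (b + 1)\<^sup>2"
    by (simp add: power2_eq_square)
  then have "2 * a\<^sup>2 * (b + 1) \<le> a\<^sup>2 * b"
    using b by (simp add: divide_le_eq le_divide_eq power2_eq_square)
  then have "a\<^sup>2 * (b + 2) \<le> 0"
    by (simp add: algebra_simps)
  moreover have "a\<^sup>2 * (b + 2) > 0"
    using a b by simp
  ultimately show False by simp
qed

section \<open>Matrix pencils and the generalized Rayleigh quotient\<close>

lemma det_eq_0_iff_kernel:
  fixes M :: "'a::field ^ 'n ^ 'n"
  shows "det M = 0 \<longleftrightarrow> (\<exists>v. v \<noteq> 0 \<and> M *v v = 0)"
  using invertible_det_nz[of M] invertible_left_inverse[of M] matrix_left_invertible_ker[of M]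
  by auto

lemma pencil_mult_vec:
  fixes P Q :: "complex ^ 'n ^ 'n"
  shows "(P - (\<chi> i j. z * Q $ i $ j)) *v v = P *v v - z *s (Q *v v)"
  by (simp add: vec_eq_iff matrix_vector_mult_def sum_subtractf sum_distrib_left algebra_simps)

lemma pencil_eigenvalue_iff: "pencil_eigenvalue P Q z \<longleftrightarrow> (\<exists>v. pencil_eigenvector P Q z v)"
  by (simp add: pencil_eigenvalue_def pencil_eigenvector_def det_eq_0_iff_kernel pencil_mult_vec)

lemma pencil_eigenvector_qform:
  assumes "pencil_eigenvector P Q (of_real x) v"
  shows "qform P v = x * qform Q v"
  using assms by (simp add: pencil_eigenvector_def qform_def cinner_scale_left)

text \<open>By the Leibniz formula, \<open>det (P - z Q)\<close> is a polynomial in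
  \<open>z\<close>; its value at 0 is \<open>det P\<close>, so it is not the zero polynomial. This
  makes the \<open>Max\<close> in \<open>lambda_max\<close> one over a finite set.\<close>

lemma finite_pencil_eigenvalues:
  assumes "det P \<noteq> 0"
  shows "finite {z. pencil_eigenvalue P Q z}"
proof -
  define p where "p = (\<Sum>\<sigma>\<in>{\<sigma>. \<sigma> permutes UNIV}.
    of_int (sign \<sigma>) * (\<Prod>i\<in>UNIV. [:P $ i $ \<sigma> i, - (Q $ i $ \<sigma> i):]))"
  have eval: "poly p z = det (P - (\<chi> i j. z * Q $ i $ j))" for z
    by (simp add: p_def det_def poly_sum poly_prod)
  have "poly p 0 = det P"
    by (simp add: p_def det_def poly_sum poly_prod)
  then have "p \<noteq> 0"
    using assms by auto
  then have "finite {z. poly p z = 0}"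
    by (rule poly_roots_finite)
  then show ?thesis
    by (simp add: eval pencil_eigenvalue_def)
qed

lemma rayleigh_max_eigenvector:
  fixes P Q :: "complex ^ 'n ^ 'n"
  assumes P: "hermitian P" and Q: "positive_definite Q"
  obtains x v where "norm v = 1" "pencil_eigenvector P Q (of_real x) v"
    "\<And>w. qform P w \<le> x * qform Q w"
proof -
  have ne: "sphere (0 :: complex ^ 'n) 1 \<noteq> {}"
    by simp
  have pos: "qform Q w > 0" if "norm w = 1" for w
    using that by (intro positive_definiteD(2)[OF Q]) auto
  have "continuous_on (sphere 0 1) (\<lambda>w. qform P w / qform Q w)"
    using pos by (intro continuous_on_divide continuous_on_qform) force
  from continuous_attains_sup[OF compact_sphere ne this] obtain v where v: "norm v = 1"
    and max: "\<And>w. norm w = 1 \<Longrightarrow> qform P w / qform Q w \<le> qform P v / qform Q v"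
    by auto
  \<comment> \<open>The maximal quotient over the unit sphere. Both forms are homogeneous of degree
    2, so the bound by \<open>x\<close> carries over from unit vectors to all
    \<open>w\<close>.\<close>
  define x where "x = qform P v / qform Q v"
  have le: "qform P w \<le> x * qform Q w" for w
  proof (cases "w = 0")
    case True
    then show ?thesis by (simp add: qform_def cinner_def)
  next
    case False
    define u where "u = complex_of_real (1 / norm w) *s w"
    have u: "norm u = 1"
    proof -
      have "u = (1 / norm w) *\<^sub>R w"
        unfolding u_def vec_eq_iff vector_scaleR_component vector_smult_component
        by (simp only: scaleR_conv_of_real) simp
      then show ?thesis using False by simp
    qed
    have w: "w = complex_of_real (norm w) *s u"
      using False by (simp add: u_def)
    have "qform P u \<le> x * qform Q u"
      using max[OF u] pos[OF u] by (simp add: x_def pos_divide_le_eq)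
    then have "(norm w)\<^sup>2 * qform P u \<le> x * ((norm w)\<^sup>2 * qform Q u)"
      by (metis mult.left_commute mult_left_mono zero_le_power2)
    then show ?thesis
      using qform_scale[of _ "complex_of_real (norm w)" u, folded w] by simp
  qed
  \<comment> \<open>The sign is such that \<open>le\<close> says \<open>H\<close> is positive
    semidefinite; the choice of \<open>x\<close> makes \<open>v\<close> isotropic for it.\<close>
  define H where "H = (\<chi> i j. of_real x * Q $ i $ j) - P"
  have H: "H *v w = of_real x *s (Q *v w) - P *v w" for w
    by (simp add: H_def vec_eq_iff matrix_vector_mult_def sum_subtractf sum_distrib_left algebra_simps)
  have qH: "qform H w = x * qform Q w - qform P w" for w
    by (simp add: qform_def H cinner_diff_left cinner_scale_left)
  have "H *v v = 0"
  proof (rule qform_isotropic_imp_kernel)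
    show "hermitian H"
      unfolding hermitian_def
    proof (intro allI)
      fix i j
      have "cnj (P $ j $ i) = P $ i $ j" "cnj (Q $ j $ i) = Q $ i $ j"
        using P positive_definiteD(1)[OF Q] unfolding hermitian_def by metis+
      then show "H $ i $ j = cnj (H $ j $ i)"
        by (simp add: H_def)
    qed
    show "qform H w \<ge> 0" for w
      using le[of w] by (simp add: qH)
    show "qform H v = 0"
      using pos[OF v] by (simp add: qH x_def)
  qed
  then have "pencil_eigenvector P Q (of_real x) v"
    using v by (auto simp: pencil_eigenvector_def H)
  with v le show ?thesis using that by blast
qed

text \<open>The maximal Rayleigh quotient \<open>x\<close> is an eigenvalue, and any real eigenvalue
  is the quotient at its own eigenvector, hence at most \<open>x\<close>. So \<open>x\<close> is
  \<open>lambda_max P Q\<close>.\<close>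

lemma lambda_max_rayleigh:
  fixes P Q :: "complex ^ 'n ^ 'n"
  assumes P: "positive_definite P" and Q: "positive_definite Q"
  shows "qform P w \<le> lambda_max P Q * qform Q w"
    and "\<exists>v. norm v = 1 \<and> pencil_eigenvector P Q (of_real (lambda_max P Q)) v"
proof -
  obtain x v where v: "norm v = 1" and eig: "pencil_eigenvector P Q (of_real x) v"
    and le: "\<And>w. qform P w \<le> x * qform Q w"
    using rayleigh_max_eigenvector[OF positive_definiteD(1)[OF P] Q] by metis
  have "P *v w \<noteq> 0" if "w \<noteq> 0" for w
    using positive_definiteD(2)[OF P that] by (auto simp: qform_def cinner_def)
  then have "det P \<noteq> 0"
    by (auto simp: det_eq_0_iff_kernel)
  then have "finite (complex_of_real -` {z. pencil_eigenvalue P Q z})"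
    by (intro finite_vimageI finite_pencil_eigenvalues inj_of_real)
  then have fin: "finite {y. pencil_eigenvalue P Q (complex_of_real y)}"
    by (simp add: vimage_def)
  have "y \<le> x" if "pencil_eigenvector P Q (of_real y) u" for y u
  proof -
    have "y * qform Q u \<le> x * qform Q u"
      using le[of u] pencil_eigenvector_qform[OF that] by simp
    moreover have "qform Q u > 0"
      using that by (intro positive_definiteD(2)[OF Q]) (simp add: pencil_eigenvector_def)
    ultimately show ?thesis by simp
  qed
  then have "lambda_max P Q = x"
    unfolding lambda_max_def using fin eig
    by (intro Max_eqI) (auto simp: pencil_eigenvalue_iff)
  with v eig le show "qform P w \<le> lambda_max P Q * qform Q w"
    "\<exists>v. norm v = 1 \<and> pencil_eigenvector P Q (of_real (lambda_max P Q)) v" by auto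
qed

section \<open>Parseval's identity and the diagonal frame operator\<close>

lemma parseval:
  assumes "orthonormal_basis \<phi>"
  shows "(\<Sum>l\<in>UNIV. (cmod (cinner x (\<phi> l)))\<^sup>2) = (norm x)\<^sup>2"
proof -
  define U where "U = (\<chi> l i. \<phi> l $ i)"
  define V where "V = (\<chi> i l. cnj (\<phi> l $ i))"
  \<comment> \<open>The rows of \<open>U\<close> are the basis vectors and \<open>V\<close> is its
    conjugate transpose, so this is orthonormality. A right inverse of a square matrix is also a
    left inverse, which gives the completeness relation \<delta>.\<close>
  have "U ** V = mat 1"
    using assms
    by (simp add: vec_eq_iff U_def V_def matrix_matrix_mult_def mat_def orthonormal_basis_def cinner_def)
  then have "V ** U = mat 1"
    by (simp add: matrix_left_right_inverse)
  then have \<delta>: "(\<Sum>l\<in>UNIV. cnj (\<phi> l $ i) * \<phi> l $ j) = (if i = j then 1 else 0)" for i j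
    by (simp add: vec_eq_iff U_def V_def matrix_matrix_mult_def mat_def)
  have "complex_of_real (\<Sum>l\<in>UNIV. (cmod (cinner x (\<phi> l)))\<^sup>2)
      = (\<Sum>l\<in>UNIV. \<Sum>i\<in>UNIV. \<Sum>j\<in>UNIV. (x $ i * cnj (x $ j)) * (cnj (\<phi> l $ i) * \<phi> l $ j))"
    by (simp add: complex_norm_square cinner_def sum_product mult_ac del: of_real_power)
  also have "\<dots> = (\<Sum>i\<in>UNIV. \<Sum>l\<in>UNIV. \<Sum>j\<in>UNIV. (x $ i * cnj (x $ j)) * (cnj (\<phi> l $ i) * \<phi> l $ j))"
    by (rule sum.swap)
  also have "\<dots> = (\<Sum>i\<in>UNIV. \<Sum>j\<in>UNIV. \<Sum>l\<in>UNIV. (x $ i * cnj (x $ j)) * (cnj (\<phi> l $ i) * \<phi> l $ j))"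
    by (intro sum.cong refl sum.swap)
  also have "\<dots> = (\<Sum>i\<in>UNIV. \<Sum>j\<in>UNIV. (x $ i * cnj (x $ j)) * (if i = j then 1 else 0))"
    by (simp add: sum_distrib_left[symmetric] \<delta> del: mult_cancel_left)
  also have "\<dots> = (\<Sum>i\<in>UNIV. x $ i * cnj (x $ i))"
    by (simp add: if_distrib cong: if_cong)
  also have "\<dots> = complex_of_real ((norm x)\<^sup>2)"
    by (simp only: cinner_self[symmetric] cinner_def)
  finally show ?thesis
    by (simp only: of_real_eq_iff)
qed

text \<open>For each \<open>j\<close> the double sum over \<open>l\<close> and \<open>m\<close>
  factors as a number times its conjugate. The conjugations in \<open>C_mat\<close> and
  \<open>cinner\<close> leave \<open>g\<close> itself, not its conjugate, next to the entries of
  \<open>A j\<close>.\<close>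

lemma qform_C_mat:
  "qform (C_mat S A k) (conj_vec g) = (\<Sum>m\<in>{1..S}. (cmod ((A m *v g) $ k))\<^sup>2)"
proof -
  let ?t = "\<lambda>l m j. A j $ k $ l * g $ l * cnj (A j $ k $ m * g $ m)"
  have "cinner (C_mat S A k *v conj_vec g) (conj_vec g) = (\<Sum>l\<in>UNIV. \<Sum>m\<in>UNIV. \<Sum>j\<in>{1..S}. ?t l m j)"
    by (simp add: cinner_def C_mat_def conj_vec_def matrix_vector_mult_def sum_distrib_right
        sum_distrib_left mult_ac)
  also have "\<dots> = (\<Sum>l\<in>UNIV. \<Sum>j\<in>{1..S}. \<Sum>m\<in>UNIV. ?t l m j)"
    by (intro sum.cong refl sum.swap)
  also have "\<dots> = (\<Sum>j\<in>{1..S}. \<Sum>l\<in>UNIV. \<Sum>m\<in>UNIV. ?t l m j)"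
    by (rule sum.swap)
  also have "\<dots> = (\<Sum>j\<in>{1..S}. (A j *v g) $ k * cnj ((A j *v g) $ k))"
    by (simp add: matrix_vector_mult_def sum_product)
  also have "\<dots> = complex_of_real (\<Sum>m\<in>{1..S}. (cmod ((A m *v g) $ k))\<^sup>2)"
    by (simp add: complex_norm_square del: of_real_power)
  finally show ?thesis
    by (simp add: qform_def)
qed

text \<open>The entrywise factor \<open>A m *v g\<close> moves, conjugated, from the window to
  \<open>f\<close>; for each \<open>m\<close>, Parseval then removes the sum over the basis.\<close>

lemma window_family_frame_sum:
  assumes "orthonormal_basis \<phi>"
  shows "(\<Sum>x\<in>{1..S} \<times> UNIV. (cmod (cinner f (window_family \<phi> A g x)))\<^sup>2)
    = (\<Sum>k\<in>UNIV. qform (C_mat S A k) (conj_vec g) * (cmod (f $ k))\<^sup>2)"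
proof -
  have "cinner f (\<phi> l * h) = cinner (f * conj_vec h) (\<phi> l)" for l h
    by (simp add: cinner_def conj_vec_def mult_ac)
  then have "(\<Sum>x\<in>{1..S} \<times> UNIV. (cmod (cinner f (window_family \<phi> A g x)))\<^sup>2)
    = (\<Sum>m\<in>{1..S}. \<Sum>l\<in>UNIV. (cmod (cinner (f * conj_vec (A m *v g)) (\<phi> l)))\<^sup>2)"
    by (simp add: sum.cartesian_product window_family_def case_prod_beta)
  also have "\<dots> = (\<Sum>m\<in>{1..S}. \<Sum>k\<in>UNIV. (cmod ((A m *v g) $ k))\<^sup>2 * (cmod (f $ k))\<^sup>2)"
    by (simp add: parseval[OF assms] norm_vec_squared conj_vec_def norm_mult power_mult_distrib mult_ac)
  also have "\<dots> = (\<Sum>k\<in>UNIV. \<Sum>m\<in>{1..S}. (cmod ((A m *v g) $ k))\<^sup>2 * (cmod (f $ k))\<^sup>2)"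
    by (rule sum.swap)
  finally show ?thesis
    by (simp add: qform_C_mat sum_distrib_right)
qed

section \<open>Frames with a diagonal frame operator\<close>

context
  fixes I :: "'i set" and \<psi> :: "'i \<Rightarrow> complex ^ 'n" and d :: "'n::finite \<Rightarrow> real"
  assumes diag: "\<And>f. (\<Sum>x\<in>I. (cmod (cinner f (\<psi> x)))\<^sup>2) = (\<Sum>k\<in>UNIV. d k * (cmod (f $ k))\<^sup>2)"
    and pos: "\<And>k. d k > 0"
begin

lemma frame_sum_axis: "(\<Sum>x\<in>I. (cmod (cinner (axis k 1) (\<psi> x)))\<^sup>2) = d k"
proof -
  have "d j * (cmod (axis k 1 $ j))\<^sup>2 = (if j = k then d j else 0)" for j
    by (simp add: axis_def)
  then show ?thesis
    by (simp add: diag)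
qed

text \<open>Standard basis vectors show necessity, a termwise estimate sufficiency. Positivity of
  \<open>b\<close> is automatic, since \<open>b\<close> dominates the positive
  \<open>d k\<close>.\<close>

lemma upper_frame_bound_diagonal: "upper_frame_bound I \<psi> b \<longleftrightarrow> (\<forall>k. d k \<le> b)"
proof
  assume b: "upper_frame_bound I \<psi> b"
  show "\<forall>k. d k \<le> b"
  proof
    fix k
    show "d k \<le> b"
      using b frame_sum_axis[of k] unfolding upper_frame_bound_def
      by (auto dest!: spec[of _ "axis k 1"])
  qed
next
  assume b: "\<forall>k. d k \<le> b"
  then have "b > 0"
    using pos less_le_trans by blast
  with b show "upper_frame_bound I \<psi> b"
    by (auto simp: upper_frame_bound_def diag norm_vec_squared sum_distrib_left
        intro!: sum_mono mult_right_mono)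
qed

text \<open>Dual to the upper bound, except that \<open>0 < a\<close> has to be stated: a number
  below every \<open>d k\<close> may be negative or zero.\<close>

lemma lower_frame_bound_diagonal: "lower_frame_bound I \<psi> a \<longleftrightarrow> 0 < a \<and> (\<forall>k. a \<le> d k)"
proof
  assume a: "lower_frame_bound I \<psi> a"
  have "a \<le> d k" for k
    using a frame_sum_axis[of k] unfolding lower_frame_bound_def
    by (auto dest!: spec[of _ "axis k 1"])
  with a show "0 < a \<and> (\<forall>k. a \<le> d k)"
    by (simp add: lower_frame_bound_def)
next
  assume "0 < a \<and> (\<forall>k. a \<le> d k)"
  then show "lower_frame_bound I \<psi> a"
    by (auto simp: lower_frame_bound_def diag norm_vec_squared sum_distrib_left
        intro!: sum_mono mult_right_mono)
qed

lemma is_frame_diagonal: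
  assumes "finite I"
  shows "is_frame I \<psi>"
proof -
  have "lower_frame_bound I \<psi> (Min (range d))" "upper_frame_bound I \<psi> (Max (range d))"
    using pos by (auto simp: lower_frame_bound_diagonal upper_frame_bound_diagonal)
  with assms show ?thesis
    by (auto simp: is_frame_def)
qed

lemma frame_cond_diagonal: "frame_cond I \<psi> = Max (range d) / Min (range d)"
proof -
  have "(LEAST b. upper_frame_bound I \<psi> b) = Max (range d)"
    by (rule Least_equality) (auto simp: upper_frame_bound_diagonal)
  moreover have "(GREATEST a. lower_frame_bound I \<psi> a) = Min (range d)"
    using pos by (intro Greatest_equality) (auto simp: lower_frame_bound_diagonal)
  ultimately show ?thesis
    by (simp add: frame_cond_def)
qed

end

section \<open>The supremum and its attainment\<close>

lemma norm_conj_vec: "norm (conj_vec v) = norm v"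
  by (simp add: norm_vec_def conj_vec_def)

lemma conj_vec_conj_vec: "conj_vec (conj_vec v) = v"
  by (simp add: conj_vec_def vec_eq_iff)

text \<open>The first two conjuncts ensure that the condition numbers and the supremum are genuine.
  In the last one \<open>g\<close> need not be normalized, because scaling it by a nonzero factor
  leaves all ratios of diagonal entries unchanged.\<close>

theorem theorem4:
  fixes \<phi> :: "'n::finite \<Rightarrow> complex ^ 'n"
    and A :: "nat \<Rightarrow> complex ^ 'n ^ 'n"
    and S :: nat
  assumes "orthonormal_basis \<phi>"
    and "\<forall>k. positive_definite (C_mat S A k)"
  defines "c \<equiv> \<lambda>g. frame_cond ({1..S} \<times> UNIV) (window_family \<phi> A g)"
    and "M \<equiv> (MAX (k, l)\<in>UNIV. lambda_max (C_mat S A k) (C_mat S A l))"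
  shows "(\<forall>g. norm g = 1 \<longrightarrow> is_frame ({1..S} \<times> UNIV) (window_family \<phi> A g))
    \<and> bdd_above (c ` {g. norm g = 1})
    \<and> (SUP g\<in>{g. norm g = 1}. c g) = M
    \<and> (\<forall>k l g. lambda_max (C_mat S A k) (C_mat S A l) = M
          \<and> pencil_eigenvector (C_mat S A k) (C_mat S A l) (complex_of_real M) (conj_vec g)
        \<longrightarrow> c g = M)"
proof -
  let ?I = "{1..S} \<times> (UNIV :: 'n set)"
  define C where "C = C_mat S A"
  define d where "d g k = qform (C k) (conj_vec g)" for g k
  define L where "L k l = lambda_max (C k) (C l)" for k l
  have pd: "positive_definite (C k)" for k
    using assms(2) by (simp add: C_def)
  have diag: "(\<Sum>x\<in>?I. (cmod (cinner f (window_family \<phi> A g x)))\<^sup>2)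
      = (\<Sum>k\<in>UNIV. d g k * (cmod (f $ k))\<^sup>2)" for f g
    using window_family_frame_sum[OF assms(1)] by (simp add: d_def C_def)
  have pos: "d g k > 0" if "conj_vec g \<noteq> 0" for g k
    using positive_definiteD(2)[OF pd that] by (simp add: d_def)
  have nz: "conj_vec g \<noteq> 0" if "norm g = 1" for g :: "complex ^ 'n"
    using that norm_conj_vec[of g] by force
  have M: "M = Max (range (\<lambda>(k, l). L k l))"
    by (simp add: M_def L_def C_def)
  have L_le: "L k l \<le> M" for k l
    unfolding M by (rule Max_ge) auto
  have c: "c g = Max (range (d g)) / Min (range (d g))" if "conj_vec g \<noteq> 0" for g
    unfolding c_def using frame_cond_diagonal[OF diag pos[OF that]] .
  have c_le: "c g \<le> M" if g: "conj_vec g \<noteq> 0" for g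
  proof -
    have "Max (range (d g)) \<in> range (d g)" "Min (range (d g)) \<in> range (d g)"
      by (simp_all add: Max_in Min_in)
    then obtain k l where k: "Max (range (d g)) = d g k" and l: "Min (range (d g)) = d g l"
      by (meson imageE)
    \<comment> \<open>With \<open>k\<close> and \<open>l\<close> the positions of the largest and
      smallest diagonal entries, the Rayleigh bound for this one pair controls
      \<open>c g\<close>.\<close>
    have "d g k \<le> L k l * d g l"
      using lambda_max_rayleigh(1)[OF pd pd] by (simp add: d_def L_def)
    also have "\<dots> \<le> M * d g l"
      using L_le pos[OF g, of l] by (simp add: mult_right_mono)
    finally show ?thesis
      using pos[OF g, of l] by (simp add: c[OF g] k l pos_divide_le_eq)
  qed
  have c_eq: "c g = M" if eig: "pencil_eigenvector (C k) (C l) (of_real M) (conj_vec g)" for k l g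
  proof -
    have g: "conj_vec g \<noteq> 0"
      using eig by (simp add: pencil_eigenvector_def)
    have "d g k = M * d g l"
      using pencil_eigenvector_qform[OF eig] by (simp add: d_def)
    then have "M = d g k / d g l"
      using pos[OF g, of l] by simp
    \<comment> \<open>An eigenvector for \<open>M\<close> makes one ratio of diagonal entries equal
      to \<open>M\<close>, so the largest ratio \<open>c g\<close> is at least \<open>M\<close>;
      \<open>c_le\<close> gives the converse.\<close>
    also have "\<dots> \<le> Max (range (d g)) / Min (range (d g))"
    proof (rule frac_le)
      show "0 \<le> Max (range (d g))"
        using pos[OF g] by (meson Max_ge finite finite_imageI less_imp_le order_trans rangeI)
      show "0 < Min (range (d g))"
        using pos[OF g] by simp
    qed simp_all
    finally show ?thesis
      using c_le[OF g] c[OF g] by simp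
  qed
  have "M \<in> range (\<lambda>(k, l). L k l)"
    unfolding M by (rule Max_in) auto
  then obtain k l where "L k l = M"
    by auto
  then obtain v where v: "norm v = 1" "pencil_eigenvector (C k) (C l) (of_real M) v"
    using lambda_max_rayleigh(2)[OF pd pd, of k l] by (auto simp: L_def)
  \<comment> \<open>The diagonal entries for \<open>g\<close> are evaluated at
    \<open>conj_vec g\<close>, so the window must be the conjugate of the eigenvector
    \<open>v\<close>.\<close>
  have attained: "norm (conj_vec v) = 1" "c (conj_vec v) = M"
    using v c_eq[of k l "conj_vec v"] by (simp_all add: norm_conj_vec conj_vec_conj_vec)
  have "(SUP g\<in>{g. norm g = 1}. c g) = M"
    using attained c_le nz by (intro cSup_eq_maximum) force+
  moreover have "bdd_above (c ` {g. norm g = 1})"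
    using c_le nz by (auto intro!: bdd_aboveI[of _ M])
  moreover have "is_frame ?I (window_family \<phi> A g)" if "norm g = 1" for g
    using is_frame_diagonal[OF diag pos[OF nz[OF that]]] by simp
  ultimately show ?thesis
    using c_eq by (auto simp: C_def)
qed

end
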